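(* Consider the full-order solution and the WST-LSPG solution over windows $0,\dots,N_w-1$, as defined in the context. Assume: (A1) there is $\kappa>0$ with $\|\boldsymbol f(\boldsymbol w,t)-\boldsymbol f(\boldsymbol y,t)\|_2\le\kappa\|\boldsymbol w-\boldsymbol y\|_2$ for all $\boldsymbol w,\boldsymbol y\in\mathbb R^{N_s}$, $t\in[0,T]$; (A2) $\sigma_{\min}(\boldsymbol A^k)-\sigma_{\max}(\boldsymbol B^k)\,\Delta t\,\kappa>0$ for every window $k\in\{0,\dots,N_w-1\}$. Set $a^k=\sigma_{\min}(\boldsymbol A^k)-\sigma_{\max}(\boldsymbol B^k)\Delta t\,\kappa$ and $b^k=\sigma_{\max}(\boldsymbol A_0^k)+\Delta t\,\kappa\,\sigma_{\max}(\boldsymbol B_0^k)$. Then for every $k\in\{0,\dots,N_w-1\}$ the error $\boldsymbol e^k=\tilde{\boldsymbol u}^k-\boldsymbol u^k$ of the WST-LSPG solution over the $k$-th window satisfies $$\|\boldsymbol e^k\|_2\le\sum_{i=0}^{k}\left(\frac{\prod_{j=0}^{k-i-1}b^{k-j}}{\prod_{j=0}^{k-i}a^{k-j}}\right)\big\|\overline{\boldsymbol r}^i(\tilde{\boldsymbol u}^i;\tilde{\boldsymbol u}_0^i)\big\|_2,$$ where products include both limits and an empty product equals $1$.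
   Context: All superscripts $k,i,k-j$ on $a,b,\boldsymbol e,\boldsymbol u,\tilde{\boldsymbol u},\overline{\boldsymbol r}$ and the matrices are window indices, not powers. $\sigma_{\min},\sigma_{\max}$ denote minimum and maximum singular values; $\|\cdot\|_2$ is the Euclidean norm. A parameter value is fixed and suppressed. Full-order model: an ODE $\dot{\boldsymbol u}=\boldsymbol f(\boldsymbol u,t)$ with $\boldsymbol f:\mathbb R^{N_s}\times[0,T]\to\mathbb R^{N_s}$ and initial state $\boldsymbol u^{\mathrm{init}}\in\mathbb R^{N_s}$ is discretized at times $t^0<t^1<\dots<t^{N_t}$ with constant step $\Delta t>0$ by a linear multistep method with stencil width $s_n$ at step $n$: coefficients $\alpha_j^n,\beta_j^n\in\mathbb R$, $0\le j\le s_n$, with $\alpha_0^n\ne0$ and $\sum_{j=0}^{s_n}\alpha_j^n=0$, and residual $$\boldsymbol r^n(\boldsymbol w^n;\boldsymbol w^{n-1},\dots,\boldsymbol w^{n-s_n})=\sum_{j=0}^{s_n}\alpha_j^n\boldsymbol w^{n-j}-\Delta t\sum_{j=0}^{s_n}\beta_j^n\boldsymbol f(\boldsymbol w^{n-j},t^{n-j}).$$ Windows: the steps $1,\dots,N_t$ are partitioned into $N_w$ consecutive windows; window $k\in\{0,\dots,N_w-1\}$ contains $N_t^k$ steps, namely $\theta(k),\dots,\theta(k)+N_t^k-1$, with $\theta(k)=1+\sum_{j=0}^{k-1}N_t^j$. The stencil width at the first step of each window is one ($s_{\theta(k)}=1$), and no stencil inside a window reaches back before the state at step $\theta(k)-1$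 (i.e. $s_{\theta(k)+\ell-1}\le\ell$ for $1\le\ell\le N_t^k$). Windowed residual: for $\boldsymbol w=[(\boldsymbol w^1)^T\cdots(\boldsymbol w^{N_t^k})^T]^T\in\mathbb R^{N_sN_t^k}$ and starting state $\boldsymbol w_0\in\mathbb R^{N_s}$, $\overline{\boldsymbol r}^k(\boldsymbol w;\boldsymbol w_0)\in\mathbb R^{N_sN_t^k}$ stacks the residuals of all steps of window $k$ (with $\boldsymbol w^\ell$ the state at step $\theta(k)+\ell-1$ and $\boldsymbol w_0$ the state at step $\theta(k)-1$). Equivalently $$\overline{\boldsymbol r}^k(\boldsymbol w;\boldsymbol w_0)=\boldsymbol A^k\boldsymbol w-\Delta t\,\boldsymbol B^k\,\overline{\boldsymbol f}^k(\boldsymbol w)+\boldsymbol A_0^k\boldsymbol w_0-\Delta t\,\boldsymbol B_0^k\boldsymbol f(\boldsymbol w_0,t^{\theta(k)-1}),$$ where $\overline{\boldsymbol f}^k(\boldsymbol w)$ stacks $\boldsymbol f(\boldsymbol w^\ell,t^{\theta(k)+\ell-1})$, $\ell=1,\dots,N_t^k$; $\boldsymbol A^k\in\mathbb R^{N_sN_t^k\times N_sN_t^k}$ has $N_s\times N_s$ block $(\ell,\ell-j)$ equal to $\alpha_j^{\theta(k)+\ell-1}\boldsymbol I$ for $0\le j\le s_{\theta(k)+\ell-1}$, $\ell-j\ge1$, other blocks zero; $\boldsymbol A_0^k\in\mathbb R^{N_sN_t^k\times N_s}$ has $\ell$-th block $\alpha_\ell^{\theta(k)+\ell-1}\boldsymbol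 I$ if $s_{\theta(k)+\ell-1}=\ell$ and zero otherwise; $\boldsymbol B^k,\boldsymbol B_0^k$ are defined identically with $\beta$ in place of $\alpha$. Full-order solution: $\boldsymbol u^k\in\mathbb R^{N_sN_t^k}$ with starting state $\boldsymbol u_0^k$ satisfies $\overline{\boldsymbol r}^k(\boldsymbol u^k;\boldsymbol u_0^k)=\boldsymbol 0$, where $\boldsymbol u_0^0=\boldsymbol u^{\mathrm{init}}$ and, for $k\ge1$, $\boldsymbol u_0^k$ is the last $N_s$-block of $\boldsymbol u^{k-1}$. WST-LSPG solution (windowed space--time least-squares Petrov--Galerkin, no hyper-reduction): computed sequentially for $k=0,\dots,N_w-1$. The starting state is $\tilde{\boldsymbol u}_0^0=\boldsymbol u^{\mathrm{init}}$ and, for $k\ge1$, $\tilde{\boldsymbol u}_0^k$ is the last $N_s$-block of $\tilde{\boldsymbol u}^{k-1}$. Given a basis matrix $\boldsymbol\Pi^k\in\mathbb R^{N_sN_t^k\times n^k}$, the affine trial subspace is $\mathcal S^k=\{\boldsymbol u_{\mathrm{ref}}^k+\boldsymbol\Pi^k\boldsymbol z:\boldsymbol z\in\mathbb R^{n^k}\}$, where $\boldsymbol u_{\mathrm{ref}}^k$ stacks $N_t^k$ copies of $\tilde{\boldsymbol u}_0^k$, and $\tilde{\boldsymbol u}^k\in\mathcal S^k$ is a minimizer of $\boldsymbol w\mapsto\|\overline{\boldsymbol r}^k(\boldsymbol w;\tilde{\boldsymbol u}_0^k)\|_2^2$ over $\mathcal S^k$. *)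

theory Defs
  imports "Jordan_Normal_Form.Char_Poly" "HOL-Analysis.L2_Norm"
begin

definition vnorm :: "real vec \<Rightarrow> real" where
  "vnorm v = L2_set (\<lambda>i. v $ i) {..<dim_vec v}"

text \<open>An $m \times n$ matrix has $\min(m,n)$ singular values, hence the smaller of the two Gram
  matrices; for a wide matrix the other one would contribute spurious zeros.\<close>

definition singular_values :: "real mat \<Rightarrow> real set" where
  "singular_values M =
    sqrt ` {ev. eigenvalue (if dim_col M \<le> dim_row M then M\<^sup>T * M else M * M\<^sup>T) ev}"

definition sigma_max :: "real mat \<Rightarrow> real" where
  "sigma_max M = Max (singular_values M)"

definition sigma_min :: "real mat \<Rightarrow> real" where
  "sigma_min M = Min (singular_values M)"

text \<open>Below, \<open>N\<close> is the state dimension, \<open>\<alpha> n j\<close> and \<open>\<beta> n j\<close> are the coefficients at step \<open>n\<close>, \<open>s n\<close>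
  is the stencil width at step \<open>n\<close>, \<open>t n\<close> is the time of step \<open>n\<close>, and \<open>Nt k\<close> is the number of steps
  in window \<open>k\<close>. In the residual at step \<open>n\<close>, \<open>x m\<close> is the state at step \<open>m\<close>; only
  $x\,(n - s_n), \dots, x\,n$ are used.\<close>

definition lmm_residual ::
  "nat \<Rightarrow> (nat \<Rightarrow> nat \<Rightarrow> real) \<Rightarrow> (nat \<Rightarrow> nat \<Rightarrow> real) \<Rightarrow> (nat \<Rightarrow> nat) \<Rightarrow> real \<Rightarrow> (nat \<Rightarrow> real)
   \<Rightarrow> (real vec \<Rightarrow> real \<Rightarrow> real vec) \<Rightarrow> nat \<Rightarrow> (nat \<Rightarrow> real vec) \<Rightarrow> real vec" where
  "lmm_residual N \<alpha> \<beta> s dt t f n x = vec N (\<lambda>i.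
     (\<Sum>j\<le>s n. \<alpha> n j * x (n - j) $ i) - dt * (\<Sum>j\<le>s n. \<beta> n j * f (x (n - j)) (t (n - j)) $ i))"

definition window_start :: "(nat \<Rightarrow> nat) \<Rightarrow> nat \<Rightarrow> nat" where
  "window_start Nt k = 1 + (\<Sum>j<k. Nt j)"

text \<open>Blocks are numbered from 0 here: block \<open>l\<close> of a window vector is the state at step
  \<open>window_start Nt k + l\<close>.\<close>

definition block :: "nat \<Rightarrow> real vec \<Rightarrow> nat \<Rightarrow> real vec" where
  "block N w l = vec N (\<lambda>i. w $ (l * N + i))"

definition window_state :: "nat \<Rightarrow> (nat \<Rightarrow> nat) \<Rightarrow> nat \<Rightarrow> real vec \<Rightarrow> real vec \<Rightarrow> nat \<Rightarrow> real vec" where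
  "window_state N Nt k w w0 n =
     (if n < window_start Nt k then w0 else block N w (n - window_start Nt k))"

definition window_residual ::
  "nat \<Rightarrow> (nat \<Rightarrow> nat) \<Rightarrow> (nat \<Rightarrow> nat \<Rightarrow> real) \<Rightarrow> (nat \<Rightarrow> nat \<Rightarrow> real) \<Rightarrow> (nat \<Rightarrow> nat) \<Rightarrow> real
   \<Rightarrow> (nat \<Rightarrow> real) \<Rightarrow> (real vec \<Rightarrow> real \<Rightarrow> real vec) \<Rightarrow> nat \<Rightarrow> real vec \<Rightarrow> real vec \<Rightarrow> real vec" where
  "window_residual N Nt \<alpha> \<beta> s dt t f k w w0 = vec (N * Nt k) (\<lambda>p.
     lmm_residual N \<alpha> \<beta> s dt t f (window_start Nt k + p div N) (window_state N Nt k w w0) $ (p mod N))"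

text \<open>The block matrices acting on the states inside the window and on its starting state; \<open>c\<close> is
  \<open>\<alpha>\<close> or \<open>\<beta>\<close>. Row \<open>p\<close> lies in block row \<open>p div N + 1\<close> when blocks are numbered from 1.\<close>

definition window_mat ::
  "nat \<Rightarrow> (nat \<Rightarrow> nat) \<Rightarrow> (nat \<Rightarrow> nat) \<Rightarrow> (nat \<Rightarrow> nat \<Rightarrow> real) \<Rightarrow> nat \<Rightarrow> real mat" where
  "window_mat N Nt s c k = mat (N * Nt k) (N * Nt k) (\<lambda>(p, q).
     let l = p div N + 1; m = q div N + 1; n = window_start Nt k + l - 1 in
     if p mod N = q mod N \<and> m \<le> l \<and> l - m \<le> s n then c n (l - m) else 0)"

definition window_mat0 ::
  "nat \<Rightarrow> (nat \<Rightarrow> nat) \<Rightarrow> (nat \<Rightarrow> nat) \<Rightarrow> (nat \<Rightarrow> nat \<Rightarrow> real) \<Rightarrow> nat \<Rightarrow> real mat" where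
  "window_mat0 N Nt s c k = mat (N * Nt k) N (\<lambda>(p, q).
     let l = p div N + 1; n = window_start Nt k + l - 1 in
     if p mod N = q \<and> s n = l then c n l else 0)"

definition start_state :: "nat \<Rightarrow> real vec \<Rightarrow> (nat \<Rightarrow> real vec) \<Rightarrow> nat \<Rightarrow> real vec" where
  "start_state N uinit u k = (if k = 0 then uinit else vec_last (u (k - 1)) N)"

definition stack_copies :: "nat \<Rightarrow> nat \<Rightarrow> real vec \<Rightarrow> real vec" where
  "stack_copies N m v = vec (N * m) (\<lambda>p. v $ (p mod N))"

definition trial_space :: "real vec \<Rightarrow> real mat \<Rightarrow> real vec set" where
  "trial_space uref P = {uref + P *\<^sub>v z | z. z \<in> carrier_vec (dim_col P)}"

end

theory Submission
  imports "HOL-Analysis.Function_Topology" Defs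
begin

text \<open>
  Subtracting the full-order residual equation on window \<open>k\<close> from the residual of the reduced solution
  leaves \<open>A e = r - A\<^sub>0 e\<^sub>0 + dt (B F + B\<^sub>0 F\<^sub>0)\<close>, where \<open>F\<close> and \<open>F\<^sub>0\<close> are differences of values of \<open>f\<close>.
  Bounding \<open>A e\<close> from below by the smallest singular value, the other products from above by the
  largest ones, and \<open>F\<close>, \<open>F\<^sub>0\<close> by the Lipschitz condition gives \<open>a \<bar>e\<bar> \<le> \<bar>r\<bar> + b \<bar>e\<^sub>0\<bar>\<close>. The starting
  error \<open>e\<^sub>0\<close> is the last block of the previous window's error, so unrolling this recursion
  yields the claim. The singular value bounds come from the Rayleigh quotient of the Gram matrix, whose maximum on the (compact) unit sphere is attained at an eigenvector.
\<close>

section \<open>Extremal Rayleigh quotients of symmetric matrices\<close>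

text \<open>Vectors of length \<open>n\<close> are modelled as functions vanishing from index
  \<open>n\<close> on, so that the product topology applies: the sphere is a closed part of a
  product of compact factors \<open>{-1..1}\<close> and \<open>{0}\<close>.\<close>

lemma compact_unit_sphere_fun:
  "compact {x :: nat \<Rightarrow> real. (\<forall>i\<ge>n. x i = 0) \<and> (\<Sum>i<n. (x i)\<^sup>2) = 1}"
proof -
  define K where "K = PiE UNIV (\<lambda>i::nat. if i < n then {-1..1::real} else {0})"
  have "compactin (product_topology (\<lambda>_. euclidean) UNIV) K"
    unfolding K_def by (subst compactin_PiE) auto
  then have K: "compact K"
    by (simp add: euclidean_product_topology)
  have "closed {x :: nat \<Rightarrow> real. (\<Sum>i<n. (x i)\<^sup>2) = 1}"
    by (intro closed_Collect_eq continuous_intros continuous_on_product_coordinates)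
  then have "compact (K \<inter> {x. (\<Sum>i<n. (x i)\<^sup>2) = 1})"
    using K by (rule compact_Int_closed[rotated])
  \<comment> \<open>Every coordinate of a unit vector lies in \<open>{-1..1}\<close>, so
    intersecting the sphere with \<open>K\<close> loses nothing.\<close>
  moreover have "x i \<in> {-1..1}" if "(\<Sum>i<n. (x i)\<^sup>2) = 1" "i < n" for x :: "nat \<Rightarrow> real" and i
  proof -
    have "(x i)\<^sup>2 \<le> (\<Sum>i<n. (x i)\<^sup>2)"
      using that by (intro member_le_sum) auto
    then show ?thesis
      using that by (auto simp: power2_le_iff_abs_le abs_le_iff abs_square_le_1)
  qed
  then have "K \<inter> {x. (\<Sum>i<n. (x i)\<^sup>2) = 1} =
      {x. (\<forall>i\<ge>n. x i = 0) \<and> (\<Sum>i<n. (x i)\<^sup>2) = 1}"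
    unfolding K_def by (auto simp: PiE_iff not_less split: if_splits)
  ultimately show ?thesis by simp
qed

lemma vnorm_sq: "(vnorm v)\<^sup>2 = v \<bullet> v"
  by (simp add: vnorm_def L2_set_def scalar_prod_def sum_nonneg lessThan_atLeast0 power2_eq_square)

lemma vnorm_nonneg [simp]: "0 \<le> vnorm v"
  by (simp add: vnorm_def)

lemma vnorm_eq_0_iff: "vnorm v = 0 \<longleftrightarrow> v = 0\<^sub>v (dim_vec v)"
  by (auto simp: vnorm_def L2_set_eq_0_iff vec_eq_iff)

text \<open>A maximiser \<open>v\<close> of the quadratic form on the unit sphere is an eigenvector;
  otherwise a small step against \<open>w = ev v - G v\<close> would raise the Rayleigh quotient
  above its maximum.\<close>

lemma ex_eigenvalue_Rayleigh_upper:
  fixes G :: "real mat"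
  assumes G: "G \<in> carrier_mat n n" and sym: "G\<^sup>T = G" and n: "0 < n"
  obtains ev where "eigenvalue G ev"
    and "\<And>x. x \<in> carrier_vec n \<Longrightarrow> x \<bullet> (G *\<^sub>v x) \<le> ev * (x \<bullet> x)"
proof -
  define S where "S = {x :: nat \<Rightarrow> real. (\<forall>i\<ge>n. x i = 0) \<and> (\<Sum>i<n. (x i)\<^sup>2) = 1}"
  define q where "q x = vec n x \<bullet> (G *\<^sub>v vec n x)" for x
  have "compact S"
    unfolding S_def by (rule compact_unit_sphere_fun)
  moreover have "(\<lambda>i. if i = 0 then 1 else 0) \<in> S"
    using n by (auto simp: S_def if_distrib[of "\<lambda>x. x ^ 2"] cong: if_cong)
  moreover have "continuous_on S q"
  proof -
    have "q = (\<lambda>x. \<Sum>i<n. x i * (\<Sum>j<n. G $$ (i, j) * x j))"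
      using G by (auto simp: q_def scalar_prod_def fun_eq_iff lessThan_atLeast0 intro!: sum.cong)
    moreover have "continuous_on S (\<lambda>x::nat\<Rightarrow>real. x i)" for i
      by (rule continuous_on_subset[OF continuous_on_product_coordinates]) simp
    ultimately show ?thesis
      by (auto intro!: continuous_intros)
  qed
  ultimately obtain v0 where v0: "v0 \<in> S" "\<And>x. x \<in> S \<Longrightarrow> q x \<le> q v0"
    using continuous_attains_sup[of S q] by blast
  define v where "v = vec n v0"
  define ev where "ev = q v0"
  have v: "v \<in> carrier_vec n" and vv: "v \<bullet> v = 1" and vGv: "v \<bullet> (G *\<^sub>v v) = ev"
    using v0(1) by (auto simp: v_def ev_def q_def S_def scalar_prod_def lessThan_atLeast0
        power2_eq_square)
  have upper: "x \<bullet> (G *\<^sub>v x) \<le> ev * (x \<bullet> x)" if x: "x \<in> carrier_vec n" for x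
  proof (cases "vnorm x = 0")
    case True
    then have "x = 0\<^sub>v n" using x by (simp add: vnorm_eq_0_iff)
    then show ?thesis using G by (simp add: scalar_prod_left_zero[of _ n])
  next
    case False
    \<comment> \<open>The normalised \<open>x\<close>, padded with zeros: its value under
      \<open>q\<close> is the Rayleigh quotient of \<open>x\<close>.\<close>
    define y where "y = (\<lambda>i. if i < n then x $ i / vnorm x else 0)"
    have y: "vec n y = (1 / vnorm x) \<cdot>\<^sub>v x"
      using x by (auto simp: y_def)
    have "(\<Sum>i<n. (y i)\<^sup>2) = (x \<bullet> x) / (vnorm x)\<^sup>2"
      using x by (simp add: y_def scalar_prod_def power_divide sum_divide_distrib
          lessThan_atLeast0 power2_eq_square)
    then have "y \<in> S"
      using False by (simp add: S_def y_def vnorm_sq[symmetric])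
    then have "q y \<le> ev"
      unfolding ev_def by (rule v0(2))
    moreover have "q y = (x \<bullet> (G *\<^sub>v x)) / (vnorm x)\<^sup>2"
      using G x by (simp add: q_def y mult_mat_vec[OF G x] power2_eq_square)
    ultimately show ?thesis
      using False by (simp add: vnorm_sq[symmetric] pos_divide_le_eq)
  qed
  \<comment> \<open>Minus half the gradient of \<open>x . G x - ev (x . x)\<close> at
    \<open>v\<close>; it vanishes exactly when \<open>v\<close> satisfies the eigenvalue equation
    for \<open>ev\<close>.\<close>
  define w where "w = ev \<cdot>\<^sub>v v - G *\<^sub>v v"
  have Gv: "G *\<^sub>v v \<in> carrier_vec n" and w: "w \<in> carrier_vec n"
    using G v by (auto simp: w_def)
  have Gw: "G *\<^sub>v w \<in> carrier_vec n"
    using G w by auto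
  define d where "d = w \<bullet> w"
  define D where "D = ev * d - w \<bullet> (G *\<^sub>v w)"
  have D: "0 \<le> D"
    using upper[OF w] by (simp add: D_def d_def)
  \<comment> \<open>The term with \<open>w . v\<close> is kept: the same term comes from
    \<open>ev\<close> times the squared norm of the perturbed vector, and the two cancel in
    \<open>quad\<close>.\<close>
  have wGv: "w \<bullet> (G *\<^sub>v v) = ev * (w \<bullet> v) - d"
  proof -
    have "G *\<^sub>v v = ev \<cdot>\<^sub>v v - w"
      using G v by (auto simp: w_def)
    then show ?thesis
      using v w by (simp add: d_def scalar_prod_minus_distrib[of w n])
  qed
  have vGw: "v \<bullet> (G *\<^sub>v w) = w \<bullet> (G *\<^sub>v v)"
    using transpose_vec_mult_scalar[OF G w v] comm_scalar_prod[OF w Gv] sym by simp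
  \<comment> \<open>First-order optimality of \<open>v\<close> along the gradient direction \<open>w\<close>.\<close>
  have quad: "- 2 * t * d \<le> t\<^sup>2 * D" for t
  proof -
    have tw: "t \<cdot>\<^sub>v w \<in> carrier_vec n" using w by simp
    have "(v + t \<cdot>\<^sub>v w) \<bullet> (G *\<^sub>v (v + t \<cdot>\<^sub>v w)) =
        ev + 2 * t * (ev * (w \<bullet> v) - d) + t\<^sup>2 * (w \<bullet> (G *\<^sub>v w))"
      using v w tw Gv Gw
      by (simp add: mult_add_distrib_mat_vec[OF G v tw] mult_mat_vec[OF G w]
          add_scalar_prod_distrib[of _ n] scalar_prod_add_distrib[of _ n] vGv vGw wGv
          power2_eq_square algebra_simps)
    moreover have "(v + t \<cdot>\<^sub>v w) \<bullet> (v + t \<cdot>\<^sub>v w) = 1 + 2 * t * (w \<bullet> v) + t\<^sup>2 * d"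
      using v w tw comm_scalar_prod[OF v w]
      by (simp add: add_scalar_prod_distrib[of _ n] scalar_prod_add_distrib[of _ n] vv d_def
          power2_eq_square algebra_simps)
    ultimately show ?thesis
      using upper[of "v + t \<cdot>\<^sub>v w"] v tw by (simp add: D_def algebra_simps)
  qed
  have "d = 0"
  proof (rule ccontr)
    assume "d \<noteq> 0"
    \<comment> \<open>A negative \<open>t\<close> makes the left side of \<open>quad\<close>
      positive. Dividing by \<open>1 + D\<close> instead of \<open>D\<close> also covers
      \<open>D = 0\<close>, and the resulting factor \<open>D / (1 + D) < 2\<close> is the
      contradiction.\<close>
    have "2 * d\<^sup>2 / (1 + D) \<le> (d\<^sup>2 * D / (1 + D)) / (1 + D)"
      using quad[of "- d / (1 + D)"] by (simp add: power2_eq_square)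
    then have "2 * d\<^sup>2 \<le> d\<^sup>2 * D / (1 + D)"
      using D by (subst (asm) divide_le_cancel) simp
    then have "d\<^sup>2 * (2 + D) \<le> 0"
      using D by (simp add: pos_le_divide_eq algebra_simps)
    then show False
      using \<open>d \<noteq> 0\<close> D by (simp add: mult_le_0_iff)
  qed
  then have "w = 0\<^sub>v n"
    using w vnorm_eq_0_iff[of w] by (simp add: d_def vnorm_sq[symmetric])
  have "(G *\<^sub>v v) $ i = (ev \<cdot>\<^sub>v v) $ i" if "i < n" for i
  proof -
    have "w $ i = 0" using \<open>w = 0\<^sub>v n\<close> that by simp
    then show ?thesis using that G v by (simp add: w_def)
  qed
  then have "G *\<^sub>v v = ev \<cdot>\<^sub>v v"
    using G v by (intro eq_vecI) auto
  moreover have "v \<noteq> 0\<^sub>v n"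
    using vv by auto
  ultimately have "eigenvalue G ev"
    using v G by (auto simp: eigenvalue_def eigenvector_def)
  then show thesis
    using upper by (rule that)
qed

text \<open>The upper bound for \<open>- G\<close>, with the sign of the eigenvalue
  reversed.\<close>

lemma ex_eigenvalue_Rayleigh_lower:
  fixes G :: "real mat"
  assumes G: "G \<in> carrier_mat n n" and sym: "G\<^sup>T = G" and n: "0 < n"
  obtains ev where "eigenvalue G ev"
    and "\<And>x. x \<in> carrier_vec n \<Longrightarrow> ev * (x \<bullet> x) \<le> x \<bullet> (G *\<^sub>v x)"
proof -
  have neg: "(- G) *\<^sub>v x = - (G *\<^sub>v x)" if "x \<in> carrier_vec n" for x
    using G that by (intro eq_vecI) auto
  have "(- G)\<^sup>T = - G"
    using sym by (simp add: transpose_uminus)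
  then obtain ev where ev: "eigenvalue (- G) ev"
    and le: "\<And>x. x \<in> carrier_vec n \<Longrightarrow> x \<bullet> ((- G) *\<^sub>v x) \<le> ev * (x \<bullet> x)"
    using ex_eigenvalue_Rayleigh_upper[of "- G" n] G n by auto
  from ev obtain v where v: "v \<in> carrier_vec n" "v \<noteq> 0\<^sub>v n" "- (G *\<^sub>v v) = ev \<cdot>\<^sub>v v"
    using G neg by (auto simp: eigenvalue_def eigenvector_def)
  then have "G *\<^sub>v v = (- ev) \<cdot>\<^sub>v v"
  proof -
    have "- ((G *\<^sub>v v) $ i) = ev * v $ i" if "i < n" for i
      using arg_cong[OF v(3), of "\<lambda>x. x $ i"] that v(1) G by simp
    then show ?thesis
      using v(1) G by (intro eq_vecI) (auto simp: minus_equation_iff)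
  qed
  then have "eigenvalue G (- ev)"
    using v G by (auto simp: eigenvalue_def eigenvector_def)
  then show thesis
  proof (rule that)
    fix x :: "real vec" assume "x \<in> carrier_vec n"
    then show "- ev * (x \<bullet> x) \<le> x \<bullet> (G *\<^sub>v x)"
      using le[of x] neg[of x] G by simp
  qed
qed

section \<open>Norm bounds by singular values\<close>

text \<open>\<open>Max\<close> and \<open>Min\<close> in \<open>sigma_max\<close> and
  \<open>sigma_min\<close> are controlled only on finite sets. Eigenvalues are roots of the
  characteristic polynomial, which is monic and hence nonzero.\<close>

lemma finite_eigenvalues:
  assumes "(G :: real mat) \<in> carrier_mat n n"
  shows "finite {ev. eigenvalue G ev}"
proof -
  have "char_poly G \<noteq> 0"
    using degree_monic_char_poly[OF assms] by auto
  then show ?thesis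
    by (simp add: eigenvalue_root_char_poly[OF assms] poly_roots_finite)
qed

context
  fixes M :: "real mat" and m n :: nat
  assumes M: "M \<in> carrier_mat m n" and tall: "n \<le> m" and n: "0 < n"
begin

lemma Gram_form:
  assumes x: "x \<in> carrier_vec n"
  shows "x \<bullet> ((M\<^sup>T * M) *\<^sub>v x) = (vnorm (M *\<^sub>v x))\<^sup>2"
proof -
  have "(M\<^sup>T * M) *\<^sub>v x = M\<^sup>T *\<^sub>v (M *\<^sub>v x)"
    using M x by (intro assoc_mult_mat_vec) auto
  moreover have "x \<bullet> (M\<^sup>T *\<^sub>v (M *\<^sub>v x)) = (M *\<^sub>v x) \<bullet> (M *\<^sub>v x)"
    using transpose_vec_mult_scalar[OF M x, of "M *\<^sub>v x"] M x
      comm_scalar_prod[of x n "M\<^sup>T *\<^sub>v (M *\<^sub>v x)"] by simp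
  ultimately show ?thesis by (simp add: vnorm_sq)
qed

lemma Gram_sym: "(M\<^sup>T * M)\<^sup>T = M\<^sup>T * M"
  using M by (simp add: transpose_mult[of _ n m _ n])

lemma Gram_carrier: "M\<^sup>T * M \<in> carrier_mat n n"
  using M by simp

text \<open>With no more columns than rows, the definition selects the Gram matrix acting on the
  domain of \<open>M\<close>. All window matrices have this shape.\<close>

lemma singular_values_tall: "singular_values M = sqrt ` {ev. eigenvalue (M\<^sup>T * M) ev}"
  using M tall by (auto simp: singular_values_def)

lemma finite_singular_values: "finite (singular_values M)"
  unfolding singular_values_tall using finite_eigenvalues[OF Gram_carrier] by simp

text \<open>It is enough that some eigenvalue dominates the Rayleigh quotient: its square root is a
  singular value and therefore at most the maximum.\<close>

lemma vnorm_mult_le_sigma_max: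
  assumes x: "x \<in> carrier_vec n"
  shows "vnorm (M *\<^sub>v x) \<le> sigma_max M * vnorm x"
proof -
  obtain ev where ev: "eigenvalue (M\<^sup>T * M) ev"
    and le: "\<And>x. x \<in> carrier_vec n \<Longrightarrow> x \<bullet> ((M\<^sup>T * M) *\<^sub>v x) \<le> ev * (x \<bullet> x)"
    using ex_eigenvalue_Rayleigh_upper[OF Gram_carrier Gram_sym n] by metis
  have "(vnorm (M *\<^sub>v x))\<^sup>2 \<le> ev * (vnorm x)\<^sup>2"
    using le[OF x] Gram_form[OF x] by (simp add: vnorm_sq)
  then have "vnorm (M *\<^sub>v x) \<le> sqrt (ev * (vnorm x)\<^sup>2)"
    by (rule real_le_rsqrt)
  also have "\<dots> = sqrt ev * vnorm x"
    by (simp add: real_sqrt_mult)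
  also have "\<dots> \<le> sigma_max M * vnorm x"
    unfolding sigma_max_def using ev finite_singular_values
    by (intro mult_right_mono Max_ge) (auto simp: singular_values_tall)
  finally show ?thesis .
qed

text \<open>The norm bound applied to a unit vector.\<close>

lemma sigma_max_nonneg: "0 \<le> sigma_max M"
proof -
  have e: "(unit_vec n 0 :: real vec) \<in> carrier_vec n"
    by simp
  have "(vnorm (unit_vec n 0))\<^sup>2 = 1"
    using n by (simp add: vnorm_sq)
  then have "vnorm (unit_vec n 0) = 1"
    using vnorm_nonneg[of "unit_vec n 0"] by (simp add: power2_eq_1_iff)
  then show ?thesis
    using order_trans[OF vnorm_nonneg vnorm_mult_le_sigma_max[OF e]] by simp
qed

text \<open>The shape \<open>n \<le> m\<close> matters here: a wide matrix has nonzero kernel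
  vectors even when all its singular values are positive.\<close>

lemma sigma_min_le_vnorm_mult:
  assumes x: "x \<in> carrier_vec n"
  shows "sigma_min M * vnorm x \<le> vnorm (M *\<^sub>v x)"
proof -
  obtain ev where ev: "eigenvalue (M\<^sup>T * M) ev"
    and le: "\<And>x. x \<in> carrier_vec n \<Longrightarrow> ev * (x \<bullet> x) \<le> x \<bullet> ((M\<^sup>T * M) *\<^sub>v x)"
    using ex_eigenvalue_Rayleigh_lower[OF Gram_carrier Gram_sym n] by metis
  have "sigma_min M * vnorm x \<le> sqrt ev * vnorm x"
    unfolding sigma_min_def using ev finite_singular_values
    by (intro mult_right_mono Min_le) (auto simp: singular_values_tall)
  also have "\<dots> = sqrt (ev * (vnorm x)\<^sup>2)"
    by (simp add: real_sqrt_mult)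
  also have "ev * (vnorm x)\<^sup>2 \<le> (vnorm (M *\<^sub>v x))\<^sup>2"
    using le[OF x] Gram_form[OF x] by (simp add: vnorm_sq)
  then have "sqrt (ev * (vnorm x)\<^sup>2) \<le> vnorm (M *\<^sub>v x)"
    by (intro real_le_lsqrt) simp_all
  finally show ?thesis .
qed

end

section \<open>Norms and blocks of stacked vectors\<close>

lemma vnorm_add_le:
  assumes "v \<in> carrier_vec n" "w \<in> carrier_vec n"
  shows "vnorm (v + w) \<le> vnorm v + vnorm w"
proof -
  have "vnorm (v + w) = L2_set (\<lambda>i. v $ i + w $ i) {..<n}"
    using assms by (auto simp: vnorm_def intro!: L2_set_cong)
  then show ?thesis
    using assms L2_set_triangle_ineq[of "\<lambda>i. v $ i" "\<lambda>i. w $ i" "{..<n}"]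
    by (simp add: vnorm_def)
qed

lemma vnorm_smult: "vnorm (c \<cdot>\<^sub>v v) = \<bar>c\<bar> * vnorm v"
proof -
  have "(vnorm (c \<cdot>\<^sub>v v))\<^sup>2 = (\<bar>c\<bar> * vnorm v)\<^sup>2"
    unfolding power_mult_distrib vnorm_sq by (simp add: power2_eq_square)
  then show ?thesis by (simp add: power2_eq_iff_nonneg)
qed

text \<open>Splits a stacked index into block number and offset, for norms as well as for
  matrix-vector products.\<close>

lemma sum_blocks:
  fixes g :: "nat \<Rightarrow> 'a :: comm_monoid_add"
  shows "(\<Sum>q<N * M. g q) = (\<Sum>m<M. \<Sum>i<N. g (m * N + i))"
proof -
  have "(\<Sum>i<N. g (m * N + i)) = sum g {m * N..<m * N + N}" for m
    using sum.shift_bounds_nat_ivl[of g 0 "m * N" N] by (simp add: lessThan_atLeast0 add.commute)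
  then show ?thesis
    by (simp add: sum.nat_group mult.commute)
qed

lemma block_index_less:
  fixes m M i N :: nat
  assumes "m < M" "i < N"
  shows "m * N + i < N * M"
proof -
  have "m * N + i < Suc m * N"
    using assms by simp
  also have "\<dots> \<le> M * N"
    using assms by (intro mult_right_mono) auto
  finally show ?thesis by (simp add: mult.commute)
qed

lemma block_carrier [simp]: "block N v m \<in> carrier_vec N"
  by (simp add: block_def)

lemma block_minus:
  assumes "v \<in> carrier_vec (N * M)" "w \<in> carrier_vec (N * M)" "m < M"
  shows "block N (v - w) m = block N v m - block N w m"
proof -
  have "m * N + i < N * M" if "i < N" for i
    using assms(3) that by (rule block_index_less)
  then show ?thesis
    using assms by (intro eq_vecI) (auto simp: block_def)
qed

lemma vnorm_sq_blocks:
  assumes "v \<in> carrier_vec (N * M)"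
  shows "(vnorm v)\<^sup>2 = (\<Sum>m<M. (vnorm (block N v m))\<^sup>2)"
  using assms by (simp add: vnorm_def L2_set_def sum_nonneg sum_blocks block_def)

text \<open>Serves to bound the starting error of a window, a single block, by the whole error of
  the preceding window.\<close>

lemma vnorm_block_le:
  assumes "v \<in> carrier_vec (N * M)" "m < M"
  shows "vnorm (block N v m) \<le> vnorm v"
proof (rule power2_le_imp_le)
  show "(vnorm (block N v m))\<^sup>2 \<le> (vnorm v)\<^sup>2"
    unfolding vnorm_sq_blocks[OF assms(1)] using assms(2)
    by (intro member_le_sum[of m "{..<M}" "\<lambda>m. (vnorm (block N v m))\<^sup>2"]) auto
qed simp

lemma vec_last_eq_block:
  assumes "v \<in> carrier_vec (N * M)" "M \<ge> 1"
  shows "vec_last v N = block N v (M - 1)"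
proof -
  have "N * M - N = (M - 1) * N"
    by (simp add: algebra_simps)
  then show ?thesis
    using assms by (simp add: vec_last_def block_def)
qed

section \<open>Matrix form of the windowed residual\<close>

lemma window_mat_carrier: "window_mat N Nt s c k \<in> carrier_mat (N * Nt k) (N * Nt k)"
  by (simp add: window_mat_def)

lemma window_mat0_carrier: "window_mat0 N Nt s c k \<in> carrier_mat (N * Nt k) N"
  by (simp add: window_mat0_def)

text \<open>Stencil terms with \<open>j \<le> p div N\<close> stay inside the window and form the
  first product; the only other possible term, \<open>j = p div N + 1\<close>, hits the starting
  state and forms the second. Coefficients and vectors are arbitrary so that the lemma serves
  \<open>\<alpha>\<close> with states and \<open>\<beta>\<close> with values of
  \<open>f\<close>.\<close>

lemma stencil_sum_eq_window_mat:
  fixes Nt s c k p N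
  defines "n \<equiv> window_start Nt k + p div N"
  assumes N: "0 < N" and p: "p < N * Nt k"
    and W: "W \<in> carrier_vec (N * Nt k)" and w0: "w0 \<in> carrier_vec N"
    and stencil: "s n \<le> Suc (p div N)"
  shows "(\<Sum>j\<le>s n. c n j * window_state N Nt k W w0 (n - j) $ (p mod N)) =
    (window_mat N Nt s c k *\<^sub>v W + window_mat0 N Nt s c k *\<^sub>v w0) $ p"
proof -
  define l where "l = p div N"
  define i where "i = p mod N"
  have n_eq: "n = window_start Nt k + l"
    by (simp add: n_def l_def)
  have i: "i < N" and l: "l < Nt k"
    using N p by (auto simp: i_def l_def less_mult_imp_div_less mult.commute)
  have s: "s n \<le> Suc l"
    using stencil by (simp add: l_def)
  have "(window_mat N Nt s c k *\<^sub>v W) $ p =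
      (\<Sum>q<N * Nt k. (if i = q mod N \<and> q div N \<le> l \<and> l - q div N \<le> s n
        then c n (l - q div N) else 0) * W $ q)"
    using p W by (auto simp: window_mat_def scalar_prod_def lessThan_atLeast0 Let_def i_def
        l_def n_def intro!: sum.cong)
  \<comment> \<open>All blocks are multiples of the identity, so each block column contributes only
    its entry at offset \<open>i\<close>.\<close>
  also have "\<dots> = (\<Sum>m<Nt k. \<Sum>i'<N. if i = i' then
      (if m \<le> l \<and> l - m \<le> s n then c n (l - m) * W $ (m * N + i') else 0) else 0)"
    unfolding sum_blocks by (intro sum.cong) auto
  also have "\<dots> = (\<Sum>m<Nt k.
      if m \<le> l \<and> l - m \<le> s n then c n (l - m) * W $ (m * N + i) else 0)"
    using i by simp
  also have "\<dots> = (\<Sum>m | m \<le> l \<and> l - m \<le> s n. c n (l - m) * W $ (m * N + i))"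
    using l by (intro sum.mono_neutral_cong_right) auto
  \<comment> \<open>Block column \<open>m\<close> corresponds to the stencil offset
    \<open>j = l - m\<close>.\<close>
  also have "\<dots> = (\<Sum>j | j \<le> l \<and> j \<le> s n. c n j * block N W (l - j) $ i)"
    by (rule sum.reindex_bij_witness[of _ "\<lambda>j. l - j" "\<lambda>m. l - m"]) (use i in \<open>auto simp: block_def\<close>)
  also have "\<dots> = (\<Sum>j | j \<le> l \<and> j \<le> s n. c n j * window_state N Nt k W w0 (n - j) $ i)"
    by (intro sum.cong) (auto simp: window_state_def n_eq)
  finally have 1: "(window_mat N Nt s c k *\<^sub>v W) $ p = \<dots>" .
  have "(window_mat0 N Nt s c k *\<^sub>v w0) $ p =
      (\<Sum>q<N. (if i = q \<and> s n = Suc l then c n (Suc l) else 0) * w0 $ q)"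
    using p w0 by (auto simp: window_mat0_def scalar_prod_def lessThan_atLeast0 Let_def i_def
        l_def n_def intro!: sum.cong)
  also have "\<dots> =
      (\<Sum>q<N. if i = q then (if s n = Suc l then c n (Suc l) * w0 $ q else 0) else 0)"
    by (intro sum.cong) auto
  also have "\<dots> = (if s n = Suc l then c n (Suc l) * w0 $ i else 0)"
    using i by simp
  finally have 2: "(window_mat0 N Nt s c k *\<^sub>v w0) $ p = \<dots>" .
  \<comment> \<open>Since \<open>window_start\<close> is at least 1, the step before the window is a
    genuine predecessor and the subtraction is not truncated.\<close>
  have "window_state N Nt k W w0 (n - Suc l) = w0"
    by (simp add: window_state_def n_eq window_start_def)
  moreover have "{j. j \<le> l \<and> j \<le> s n} = (if s n = Suc l then {..l} else {..s n})"
    using s by auto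
  ultimately have "(\<Sum>j\<le>s n. c n j * window_state N Nt k W w0 (n - j) $ i) =
      (window_mat N Nt s c k *\<^sub>v W) $ p + (window_mat0 N Nt s c k *\<^sub>v w0) $ p"
    unfolding 1 2 by simp
  then show ?thesis
    using p by (simp add: i_def window_mat0_def)
qed

definition window_rhs ::
  "nat \<Rightarrow> (nat \<Rightarrow> nat) \<Rightarrow> (nat \<Rightarrow> real) \<Rightarrow> (real vec \<Rightarrow> real \<Rightarrow> real vec) \<Rightarrow> nat \<Rightarrow> real vec \<Rightarrow> real vec"
  where
  "window_rhs N Nt t f k w = vec (N * Nt k) (\<lambda>p.
     f (block N w (p div N)) (t (window_start Nt k + p div N)) $ (p mod N))"

lemma window_rhs_carrier: "window_rhs N Nt t f k w \<in> carrier_vec (N * Nt k)"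
  by (simp add: window_rhs_def)

lemma block_window_rhs_index:
  assumes "l < Nt k" "i < N"
  shows "block N (window_rhs N Nt t f k w) l $ i = f (block N w l) (t (window_start Nt k + l)) $ i"
proof -
  have "l * N + i < N * Nt k"
    using assms by (rule block_index_less)
  then show ?thesis
    using assms by (simp add: block_def window_rhs_def)
qed

text \<open>The nonlinear part is itself a stencil sum, over the stacked values of \<open>f\<close>,
  so the matrix form of stencil sums applies once with \<open>\<alpha>\<close> and once with
  \<open>\<beta>\<close>.\<close>

lemma window_residual_eq:
  assumes N: "0 < N"
    and stencil: "\<And>l. l < Nt k \<Longrightarrow> s (window_start Nt k + l) \<le> Suc l"
    and w: "w \<in> carrier_vec (N * Nt k)" and w0: "w0 \<in> carrier_vec N"
    and f0: "f w0 (t (window_start Nt k - 1)) \<in> carrier_vec N"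
  shows "window_residual N Nt \<alpha> \<beta> s dt t f k w w0 =
    (window_mat N Nt s \<alpha> k *\<^sub>v w + window_mat0 N Nt s \<alpha> k *\<^sub>v w0) -
    dt \<cdot>\<^sub>v (window_mat N Nt s \<beta> k *\<^sub>v window_rhs N Nt t f k w +
      window_mat0 N Nt s \<beta> k *\<^sub>v f w0 (t (window_start Nt k - 1)))" (is "?r = ?R")
proof (rule eq_vecI)
  show "dim_vec ?r = dim_vec ?R"
    by (simp add: window_residual_def window_mat0_def)
  fix p assume "p < dim_vec ?R"
  then have p: "p < N * Nt k"
    by (simp add: window_mat0_def)
  define n where "n = window_start Nt k + p div N"
  have i: "p mod N < N" and l: "p div N < Nt k"
    using N p by (auto simp: less_mult_imp_div_less mult.commute)
  note st = stencil[OF l]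
  \<comment> \<open>Evaluating \<open>f\<close> commutes with looking up a state: its values form a
    window vector with starting value \<open>f w0\<close>.\<close>
  have rhs: "f (window_state N Nt k w w0 (n - j)) (t (n - j)) $ (p mod N) =
      window_state N Nt k (window_rhs N Nt t f k w) (f w0 (t (window_start Nt k - 1))) (n - j)
        $ (p mod N)" if j: "j \<le> s n" for j
  proof (cases "j \<le> p div N")
    case True
    then have "n - j - window_start Nt k < Nt k" "window_start Nt k + (n - j - window_start Nt k) = n - j"
      "\<not> n - j < window_start Nt k"
      using l by (auto simp: n_def)
    then show ?thesis
      using block_window_rhs_index[of "n - j - window_start Nt k" Nt k "p mod N" N t f w] i
      by (simp add: window_state_def)
  next
    case False
    then have "n - j = window_start Nt k - 1"
      using j st by (auto simp: n_def)
    then show ?thesis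
      by (simp add: window_state_def window_start_def)
  qed
  have "?r $ p = (\<Sum>j\<le>s n. \<alpha> n j * window_state N Nt k w w0 (n - j) $ (p mod N)) -
      dt * (\<Sum>j\<le>s n. \<beta> n j * window_state N Nt k (window_rhs N Nt t f k w)
        (f w0 (t (window_start Nt k - 1))) (n - j) $ (p mod N))"
    using p i rhs by (simp add: window_residual_def lmm_residual_def n_def[symmetric])
  also have "\<dots> = ?R $ p"
    using p stencil_sum_eq_window_mat[of N p Nt k w w0 s \<alpha>, OF N p w w0 st]
      stencil_sum_eq_window_mat[of N p Nt k "window_rhs N Nt t f k w" _ s \<beta>,
        OF N p window_rhs_carrier f0 st]
    by (simp add: n_def window_mat0_def)
  finally show "?r $ p = ?R $ p" .
qed

section \<open>Error estimate on a single window\<close>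

text \<open>Squared norms add over blocks, so the blockwise Lipschitz bound passes to the stacked
  vector with the same constant.\<close>

lemma vnorm_window_rhs_diff_le:
  assumes dim: "\<And>x \<tau>. x \<in> carrier_vec N \<Longrightarrow> \<tau> \<in> I \<Longrightarrow> f x \<tau> \<in> carrier_vec N"
    and lip: "\<And>x y \<tau>. x \<in> carrier_vec N \<Longrightarrow> y \<in> carrier_vec N \<Longrightarrow> \<tau> \<in> I \<Longrightarrow>
      vnorm (f x \<tau> - f y \<tau>) \<le> \<kappa> * vnorm (x - y)"
    and time: "\<And>l. l < Nt k \<Longrightarrow> t (window_start Nt k + l) \<in> I"
    and \<kappa>: "0 \<le> \<kappa>"
    and w: "w \<in> carrier_vec (N * Nt k)" and y: "y \<in> carrier_vec (N * Nt k)"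
  shows "vnorm (window_rhs N Nt t f k w - window_rhs N Nt t f k y) \<le> \<kappa> * vnorm (w - y)"
proof (rule power2_le_imp_le)
  let ?F = "window_rhs N Nt t f k"
  have rhs: "?F x \<in> carrier_vec (N * Nt k)" for x
    by (rule window_rhs_carrier)
  have block: "(vnorm (block N (?F w - ?F y) l))\<^sup>2 \<le> \<kappa>\<^sup>2 * (vnorm (block N (w - y) l))\<^sup>2"
    if l: "l < Nt k" for l
  proof -
    have "block N (?F x) l = f (block N x l) (t (window_start Nt k + l))" for x
      using dim[OF block_carrier time[OF l], of x l] block_window_rhs_index[of l Nt k, OF l]
      by (intro eq_vecI) (auto simp: block_def)
    then have "vnorm (block N (?F w - ?F y) l) \<le> \<kappa> * vnorm (block N (w - y) l)"
      using lip[OF block_carrier block_carrier time[OF l], of w l y l]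
      by (simp add: block_minus[OF w y l] block_minus[OF rhs rhs l])
    then show ?thesis
      using power_mono[of _ _ 2] by (fastforce simp: power_mult_distrib)
  qed
  have "(vnorm (?F w - ?F y))\<^sup>2 = (\<Sum>l<Nt k. (vnorm (block N (?F w - ?F y) l))\<^sup>2)"
    by (rule vnorm_sq_blocks) (auto simp: window_rhs_def)
  also have "\<dots> \<le> (\<Sum>l<Nt k. \<kappa>\<^sup>2 * (vnorm (block N (w - y) l))\<^sup>2)"
    using block by (intro sum_mono) auto
  also have "\<dots> = (\<kappa> * vnorm (w - y))\<^sup>2"
    using w y by (simp add: power_mult_distrib sum_distrib_left vnorm_sq_blocks[of "w - y" N "Nt k"])
  finally show "(vnorm (?F w - ?F y))\<^sup>2 \<le> (\<kappa> * vnorm (w - y))\<^sup>2" .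
qed (use \<kappa> in simp)

text \<open>An a posteriori estimate for a candidate \<open>w\<close> against an exact solution
  \<open>y\<close>, each with its own starting state. The term with \<open>B\<close> moves to the
  left because \<open>F\<close> is bounded by the error itself.\<close>

lemma window_error_bound:
  fixes Nt s k N \<alpha> \<beta>
  defines "A \<equiv> window_mat N Nt s \<alpha> k" and "A0 \<equiv> window_mat0 N Nt s \<alpha> k"
    and "B \<equiv> window_mat N Nt s \<beta> k" and "B0 \<equiv> window_mat0 N Nt s \<beta> k"
  assumes N: "0 < N" and Nt: "0 < Nt k"
    and stencil: "\<And>l. l < Nt k \<Longrightarrow> s (window_start Nt k + l) \<le> Suc l"
    and dim: "\<And>x \<tau>. x \<in> carrier_vec N \<Longrightarrow> \<tau> \<in> I \<Longrightarrow> f x \<tau> \<in> carrier_vec N"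
    and lip: "\<And>x y \<tau>. x \<in> carrier_vec N \<Longrightarrow> y \<in> carrier_vec N \<Longrightarrow> \<tau> \<in> I \<Longrightarrow>
      vnorm (f x \<tau> - f y \<tau>) \<le> \<kappa> * vnorm (x - y)"
    and time: "\<And>l. l \<le> Nt k \<Longrightarrow> t (window_start Nt k - 1 + l) \<in> I"
    and \<kappa>: "0 \<le> \<kappa>" and dt: "0 \<le> dt"
    and w: "w \<in> carrier_vec (N * Nt k)" and w0: "w0 \<in> carrier_vec N"
    and y: "y \<in> carrier_vec (N * Nt k)" and y0: "y0 \<in> carrier_vec N"
    and res0: "window_residual N Nt \<alpha> \<beta> s dt t f k y y0 = 0\<^sub>v (N * Nt k)"
  shows "(sigma_min A - sigma_max B * dt * \<kappa>) * vnorm (w - y) \<le>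
    vnorm (window_residual N Nt \<alpha> \<beta> s dt t f k w w0) +
    (sigma_max A0 + dt * \<kappa> * sigma_max B0) * vnorm (w0 - y0)"
proof -
  let ?n = "N * Nt k"
  define r where "r = window_residual N Nt \<alpha> \<beta> s dt t f k w w0"
  define F where "F = window_rhs N Nt t f k w - window_rhs N Nt t f k y"
  define \<tau> where "\<tau> = t (window_start Nt k - 1)"
  define F0 where "F0 = f w0 \<tau> - f y0 \<tau>"
  have \<tau>: "\<tau> \<in> I"
    using time[of 0] by (simp add: \<tau>_def)
  \<comment> \<open>The hypothesis counts from the step before the window, so block \<open>l\<close>
    sits at offset \<open>Suc l\<close>.\<close>
  have time': "t (window_start Nt k + l) \<in> I" if "l < Nt k" for l
    using time[of "Suc l"] that by (simp add: window_start_def)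
  note fw = dim[OF w0 \<tau>] and fy = dim[OF y0 \<tau>]
  have A: "A \<in> carrier_mat ?n ?n" and B: "B \<in> carrier_mat ?n ?n"
    and A0: "A0 \<in> carrier_mat ?n N" and B0: "B0 \<in> carrier_mat ?n N"
    by (simp_all add: A_def B_def A0_def B0_def window_mat_carrier window_mat0_carrier)
  have n: "0 < ?n" and tall: "N \<le> ?n"
    using N Nt by auto
  have e: "w - y \<in> carrier_vec ?n" and e0: "w0 - y0 \<in> carrier_vec N"
    and F: "F \<in> carrier_vec ?n" and F0: "F0 \<in> carrier_vec N"
    using w y w0 y0 fw fy by (auto simp: F_def F0_def window_rhs_def)
  have r: "r = (A *\<^sub>v w + A0 *\<^sub>v w0) - dt \<cdot>\<^sub>v (B *\<^sub>v window_rhs N Nt t f k w + B0 *\<^sub>v f w0 \<tau>)"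
    unfolding r_def A_def A0_def B_def B0_def \<tau>_def
    using N stencil w w0 fw by (intro window_residual_eq) (auto simp: \<tau>_def)
  have y_eq: "0\<^sub>v ?n = (A *\<^sub>v y + A0 *\<^sub>v y0) - dt \<cdot>\<^sub>v (B *\<^sub>v window_rhs N Nt t f k y + B0 *\<^sub>v f y0 \<tau>)"
    unfolding res0[symmetric] A_def A0_def B_def B0_def \<tau>_def
    using N stencil y y0 fy by (intro window_residual_eq) (auto simp: \<tau>_def)
  have rhs: "window_rhs N Nt t f k x \<in> carrier_vec ?n" for x
    by (rule window_rhs_carrier)
  have carr: "A *\<^sub>v x \<in> carrier_vec ?n" "B *\<^sub>v x \<in> carrier_vec ?n"
    "A0 *\<^sub>v x \<in> carrier_vec ?n" "B0 *\<^sub>v x \<in> carrier_vec ?n" for x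
    using A B A0 B0 by (auto intro!: carrier_vecI)
  have r_carr: "r \<in> carrier_vec ?n"
    unfolding r using carr by auto
  \<comment> \<open>The difference of \<open>r\<close> and \<open>y_eq\<close>, solved for the
    product with \<open>A\<close>. The factor \<open>- 1\<close> lets \<open>vnorm_add_le\<close>
    and \<open>vnorm_smult\<close> suffice for the estimate.\<close>
  have eq: "A *\<^sub>v (w - y) = r + ((- 1) \<cdot>\<^sub>v (A0 *\<^sub>v (w0 - y0)) + dt \<cdot>\<^sub>v (B *\<^sub>v F + B0 *\<^sub>v F0))"
  proof (rule eq_vecI)
    fix i assume "i < dim_vec (r + ((- 1) \<cdot>\<^sub>v (A0 *\<^sub>v (w0 - y0)) + dt \<cdot>\<^sub>v (B *\<^sub>v F + B0 *\<^sub>v F0)))"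
    then have i: "i < ?n" using B0 by simp
    have dist: "A *\<^sub>v (w - y) = A *\<^sub>v w - A *\<^sub>v y" "A0 *\<^sub>v (w0 - y0) = A0 *\<^sub>v w0 - A0 *\<^sub>v y0"
      "B *\<^sub>v F = B *\<^sub>v window_rhs N Nt t f k w - B *\<^sub>v window_rhs N Nt t f k y"
      "B0 *\<^sub>v F0 = B0 *\<^sub>v f w0 \<tau> - B0 *\<^sub>v f y0 \<tau>"
      unfolding F_def F0_def
      by (rule mult_minus_distrib_mat_vec[OF A w y] mult_minus_distrib_mat_vec[OF A0 w0 y0]
          mult_minus_distrib_mat_vec[OF B rhs rhs]
          mult_minus_distrib_mat_vec[OF B0 fw fy])+
    have idx: "(u + v) $ i = u $ i + v $ i" "(u - v) $ i = u $ i - v $ i" "(c \<cdot>\<^sub>v v) $ i = c * v $ i"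
      if "v \<in> carrier_vec ?n" for u v :: "real vec" and c
      using that i by auto
    \<comment> \<open>Entries of matrix products are kept opaque from here on, so that the identity
      becomes plain arithmetic in them.\<close>
    have "0 = (A *\<^sub>v y) $ i + (A0 *\<^sub>v y0) $ i
        - dt * ((B *\<^sub>v window_rhs N Nt t f k y) $ i + (B0 *\<^sub>v f y0 \<tau>) $ i)"
      using arg_cong[OF y_eq, of "\<lambda>v. v $ i"] i carr
      by (simp add: idx del: index_mult_mat_vec)
    then show "(A *\<^sub>v (w - y)) $ i =
        (r + ((- 1) \<cdot>\<^sub>v (A0 *\<^sub>v (w0 - y0)) + dt \<cdot>\<^sub>v (B *\<^sub>v F + B0 *\<^sub>v F0))) $ i"
      using i carr unfolding dist r
      by (simp add: idx algebra_simps del: index_mult_mat_vec)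
  qed (use A B0 in simp)
  have "sigma_min A * vnorm (w - y) \<le> vnorm (A *\<^sub>v (w - y))"
    using sigma_min_le_vnorm_mult[OF A order_refl n e] .
  also have "\<dots> \<le> vnorm r + (vnorm (A0 *\<^sub>v (w0 - y0)) + dt * (vnorm (B *\<^sub>v F) + vnorm (B0 *\<^sub>v F0)))"
  proof -
    have "vnorm (A *\<^sub>v (w - y)) \<le>
        vnorm r + vnorm ((- 1) \<cdot>\<^sub>v (A0 *\<^sub>v (w0 - y0)) + dt \<cdot>\<^sub>v (B *\<^sub>v F + B0 *\<^sub>v F0))"
      unfolding eq using r_carr carr by (intro vnorm_add_le[of _ ?n]) auto
    also have "vnorm ((- 1) \<cdot>\<^sub>v (A0 *\<^sub>v (w0 - y0)) + dt \<cdot>\<^sub>v (B *\<^sub>v F + B0 *\<^sub>v F0)) \<le>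
        vnorm ((- 1) \<cdot>\<^sub>v (A0 *\<^sub>v (w0 - y0))) + vnorm (dt \<cdot>\<^sub>v (B *\<^sub>v F + B0 *\<^sub>v F0))"
      using carr by (intro vnorm_add_le[of _ ?n]) auto
    also have "\<dots> \<le> vnorm (A0 *\<^sub>v (w0 - y0)) + dt * (vnorm (B *\<^sub>v F) + vnorm (B0 *\<^sub>v F0))"
      unfolding vnorm_smult using dt carr by (auto intro!: mult_left_mono vnorm_add_le[of _ ?n])
    finally show ?thesis by simp
  qed
  also have "vnorm (A0 *\<^sub>v (w0 - y0)) \<le> sigma_max A0 * vnorm (w0 - y0)"
    using vnorm_mult_le_sigma_max[OF A0 tall N e0] .
  also have "vnorm (B *\<^sub>v F) \<le> sigma_max B * (\<kappa> * vnorm (w - y))"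
  proof -
    have "vnorm F \<le> \<kappa> * vnorm (w - y)"
      unfolding F_def using dim lip time' \<kappa> w y by (rule vnorm_window_rhs_diff_le)
    then show ?thesis
      using vnorm_mult_le_sigma_max[OF B order_refl n F] sigma_max_nonneg[OF B order_refl n]
        mult_left_mono order_trans by blast
  qed
  also have "vnorm (B0 *\<^sub>v F0) \<le> sigma_max B0 * (\<kappa> * vnorm (w0 - y0))"
  proof -
    have "vnorm F0 \<le> \<kappa> * vnorm (w0 - y0)"
      unfolding F0_def using lip[OF w0 y0 \<tau>] .
    then show ?thesis
      using vnorm_mult_le_sigma_max[OF B0 tall N F0] sigma_max_nonneg[OF B0 tall N]
        mult_left_mono order_trans by blast
  qed
  finally have "sigma_min A * vnorm (w - y) \<le> vnorm r + (sigma_max A0 * vnorm (w0 - y0) +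
      dt * (sigma_max B * (\<kappa> * vnorm (w - y)) + sigma_max B0 * (\<kappa> * vnorm (w0 - y0))))"
    using dt by (simp add: mult_left_mono)
  \<comment> \<open>Collecting the multiples of \<open>vnorm (w - y)\<close> on the left gives the
    stability factor.\<close>
  then show ?thesis
    by (simp add: r_def algebra_simps)
qed

section \<open>Accumulation of errors over the windows\<close>

text \<open>Each step multiplies all earlier contributions by \<open>b (Suc k) / a (Suc k)\<close>
  and adds one new residual term.\<close>

lemma linear_recursion_bound:
  fixes a b E R :: "nat \<Rightarrow> real"
  assumes a: "\<And>k. k < n \<Longrightarrow> 0 < a k" and b: "\<And>k. k < n \<Longrightarrow> 0 \<le> b k"
    and init: "0 < n \<Longrightarrow> a 0 * E 0 \<le> R 0"
    and step: "\<And>k. Suc k < n \<Longrightarrow> a (Suc k) * E (Suc k) \<le> R (Suc k) + b (Suc k) * E k"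
    and k: "k < n"
  shows "E k \<le> (\<Sum>i\<le>k. ((\<Prod>j<k - i. b (k - j)) / (\<Prod>j\<le>k - i. a (k - j))) * R i)"
  using k
proof (induction k)
  case 0
  then show ?case
    using init a[of 0] by (simp add: pos_le_divide_eq mult.commute)
next
  case (Suc k)
  let ?c = "\<lambda>k i. (\<Prod>j<k - i. b (k - j)) / (\<Prod>j\<le>k - i. a (k - j))"
  \<comment> \<open>The products run backwards from the current window, so the new factor is the one
    at \<open>j = 0\<close> and they are split at the front.\<close>
  have shift: "?c (Suc k) i = b (Suc k) / a (Suc k) * ?c k i" if "i \<le> k" for i
    unfolding Suc_diff_le[OF that] by (simp add: prod.lessThan_Suc_shift prod.atMost_Suc_shift
        del: prod.lessThan_Suc prod.atMost_Suc)
  have "E (Suc k) \<le> (R (Suc k) + b (Suc k) * E k) / a (Suc k)"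
    using step[OF Suc.prems] a[OF Suc.prems] by (simp add: pos_le_divide_eq mult.commute)
  also have "\<dots> = R (Suc k) / a (Suc k) + b (Suc k) / a (Suc k) * E k"
    by (simp add: add_divide_distrib)
  also have "\<dots> \<le> R (Suc k) / a (Suc k) + b (Suc k) / a (Suc k) * (\<Sum>i\<le>k. ?c k i * R i)"
    using Suc a[OF Suc.prems] b[OF Suc.prems] by (intro add_left_mono mult_left_mono) auto
  \<comment> \<open>The separate term is the summand \<open>i = Suc k\<close>: its numerator is an
    empty product and its denominator the single factor \<open>a (Suc k)\<close>.\<close>
  also have "\<dots> = (\<Sum>i\<le>Suc k. ?c (Suc k) i * R i)"
  proof -
    have "b (Suc k) / a (Suc k) * (\<Sum>i\<le>k. ?c k i * R i) = (\<Sum>i\<le>k. ?c (Suc k) i * R i)"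
      unfolding sum_distrib_left by (intro sum.cong) (simp_all only: shift atMost_iff mult.assoc)
    then show ?thesis by simp
  qed
  finally show ?case .
qed

theorem corollary6p2p2:
  fixes N Nw Ntot :: nat
    and Nt s dimz :: "nat \<Rightarrow> nat"
    and \<alpha> \<beta> :: "nat \<Rightarrow> nat \<Rightarrow> real"
    and dt T \<kappa> :: real
    and t a b :: "nat \<Rightarrow> real"
    and f :: "real vec \<Rightarrow> real \<Rightarrow> real vec"
    and uinit :: "real vec"
    and P :: "nat \<Rightarrow> real mat"
    and u ut :: "nat \<Rightarrow> real vec"
  assumes N_pos: "N \<ge> 1"
    and Nt_pos: "\<And>k. k < Nw \<Longrightarrow> Nt k \<ge> 1"
    and Ntot: "Ntot = (\<Sum>k<Nw. Nt k)"
    and dt_pos: "dt > 0"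
    and time_step: "\<And>n. n < Ntot \<Longrightarrow> t (Suc n) = t n + dt"
    and time_range: "\<And>n. n \<le> Ntot \<Longrightarrow> t n \<in> {0..T}"
    and f_dim: "\<And>w \<tau>. w \<in> carrier_vec N \<Longrightarrow> \<tau> \<in> {0..T} \<Longrightarrow> f w \<tau> \<in> carrier_vec N"
    and uinit_dim: "uinit \<in> carrier_vec N"
    and alpha0: "\<And>n. n \<in> {1..Ntot} \<Longrightarrow> \<alpha> n 0 \<noteq> 0"
    and alpha_sum: "\<And>n. n \<in> {1..Ntot} \<Longrightarrow> (\<Sum>j\<le>s n. \<alpha> n j) = 0"
    and stencil_first: "\<And>k. k < Nw \<Longrightarrow> s (window_start Nt k) = 1"
    and stencil_window: "\<And>k l. k < Nw \<Longrightarrow> l \<in> {1..Nt k} \<Longrightarrow> s (window_start Nt k + l - 1) \<le> l"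
    and fom_dim: "\<And>k. k < Nw \<Longrightarrow> u k \<in> carrier_vec (N * Nt k)"
    and fom: "\<And>k. k < Nw \<Longrightarrow>
      window_residual N Nt \<alpha> \<beta> s dt t f k (u k) (start_state N uinit u k) = 0\<^sub>v (N * Nt k)"
    and P_dim: "\<And>k. k < Nw \<Longrightarrow> P k \<in> carrier_mat (N * Nt k) (dimz k)"
    and wst_lspg: "\<And>k. k < Nw \<Longrightarrow>
      is_arg_min
        (\<lambda>w. (vnorm (window_residual N Nt \<alpha> \<beta> s dt t f k w (start_state N uinit ut k)))\<^sup>2)
        (\<lambda>w. w \<in> trial_space (stack_copies N (Nt k) (start_state N uinit ut k)) (P k))
        (ut k)"
    and kappa_pos: "\<kappa> > 0"
    and lipschitz: "\<And>w y \<tau>. w \<in> carrier_vec N \<Longrightarrow> y \<in> carrier_vec N \<Longrightarrow> \<tau> \<in> {0..T} \<Longrightarrow>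
      vnorm (f w \<tau> - f y \<tau>) \<le> \<kappa> * vnorm (w - y)"
    and stability: "\<And>k. k < Nw \<Longrightarrow>
      sigma_min (window_mat N Nt s \<alpha> k) - sigma_max (window_mat N Nt s \<beta> k) * dt * \<kappa> > 0"
    and a_eq: "\<And>k. a k =
      sigma_min (window_mat N Nt s \<alpha> k) - sigma_max (window_mat N Nt s \<beta> k) * dt * \<kappa>"
    and b_eq: "\<And>k. b k =
      sigma_max (window_mat0 N Nt s \<alpha> k) + dt * \<kappa> * sigma_max (window_mat0 N Nt s \<beta> k)"
  shows "\<forall>k<Nw. vnorm (ut k - u k) \<le>
    (\<Sum>i\<le>k. ((\<Prod>j<k - i. b (k - j)) / (\<Prod>j\<le>k - i. a (k - j))) *
      vnorm (window_residual N Nt \<alpha> \<beta> s dt t f i (ut i) (start_state N uinit ut i)))"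
proof -
  let ?ws = "window_start Nt"
  have N: "0 < N" using N_pos by simp
  have Nt: "0 < Nt k" if "k < Nw" for k
    using Nt_pos[OF that] by simp
  have tall: "N \<le> N * Nt k" if "k < Nw" for k
    using Nt[OF that] by simp
  \<comment> \<open>Membership in the trial space determines the length: a vector sum has the length
    of its second summand, here the number of rows of \<open>P k\<close>.\<close>
  have ut_dim: "ut k \<in> carrier_vec (N * Nt k)" if "k < Nw" for k
  proof -
    obtain z where "ut k = stack_copies N (Nt k) (start_state N uinit ut k) + P k *\<^sub>v z"
      using wst_lspg[OF \<open>k < Nw\<close>] by (auto simp: is_arg_min_def trial_space_def)
    then show ?thesis
      using P_dim[OF that] by (intro carrier_vecI) simp
  qed
  have start_dim: "start_state N uinit x k \<in> carrier_vec N" for x k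
    using uinit_dim by (simp add: start_state_def)
  have time: "t (?ws k - 1 + l) \<in> {0..T}" if "k < Nw" "l \<le> Nt k" for k l
  proof (rule time_range)
    \<comment> \<open>The last step of window \<open>k\<close> is the total length of the windows up
      to \<open>k\<close>.\<close>
    have "(\<Sum>j<Suc k. Nt j) \<le> Ntot"
      unfolding Ntot using that(1) by (intro sum_mono2) auto
    then show "?ws k - 1 + l \<le> Ntot"
      using that(2) by (simp add: window_start_def)
  qed
  have step: "a k * vnorm (ut k - u k) \<le>
      vnorm (window_residual N Nt \<alpha> \<beta> s dt t f k (ut k) (start_state N uinit ut k)) +
      b k * vnorm (start_state N uinit ut k - start_state N uinit u k)" if k: "k < Nw" for k
    unfolding a_eq b_eq
  proof (rule window_error_bound[where I = "{0..T}"])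
    show "s (?ws k + l) \<le> Suc l" if "l < Nt k" for l
      using stencil_window[OF k, of "Suc l"] that by simp
  qed (use N Nt f_dim lipschitz time k kappa_pos dt_pos ut_dim start_dim fom_dim fom in auto)
  have start_diff: "vnorm (start_state N uinit ut (Suc k) - start_state N uinit u (Suc k)) \<le>
      vnorm (ut k - u k)" if "k < Nw" for k
  proof -
    note d = ut_dim[OF that] fom_dim[OF that]
    have last: "Nt k - 1 < Nt k" using Nt[OF that] by simp
    have "ut k - u k \<in> carrier_vec (N * Nt k)" using d by auto
    from vnorm_block_le[OF this last, unfolded block_minus[OF d last]] show ?thesis
      using vec_last_eq_block[OF d(1) Nt_pos[OF that]] vec_last_eq_block[OF d(2) Nt_pos[OF that]]
      by (simp add: start_state_def)
  qed
  have b_nonneg: "0 \<le> b k" if "k < Nw" for k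
  proof -
    have "0 \<le> sigma_max (window_mat0 N Nt s c k)" for c
      using window_mat0_carrier tall[OF that] N by (rule sigma_max_nonneg)
    then show ?thesis
      unfolding b_eq using dt_pos kappa_pos by simp
  qed
  show ?thesis
  proof (intro allI impI)
    fix k assume "k < Nw"
    then show "vnorm (ut k - u k) \<le>
      (\<Sum>i\<le>k. ((\<Prod>j<k - i. b (k - j)) / (\<Prod>j\<le>k - i. a (k - j))) *
        vnorm (window_residual N Nt \<alpha> \<beta> s dt t f i (ut i) (start_state N uinit ut i)))"
    \<comment> \<open>The rotation puts the premise \<open>k < n\<close> first, where the chained
      fact fixes \<open>n\<close> as \<open>Nw\<close>.\<close>
    proof (rule linear_recursion_bound[rotated -1])
      show "0 < a k" if "k < Nw" for k
        using stability[OF that] by (simp add: a_eq)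
      show "a 0 * vnorm (ut 0 - u 0) \<le>
          vnorm (window_residual N Nt \<alpha> \<beta> s dt t f 0 (ut 0) (start_state N uinit ut 0))"
        if "0 < Nw"
      proof -
        \<comment> \<open>Both solutions start from \<open>uinit\<close>, so no error enters the
          first window.\<close>
        have "vnorm (uinit - uinit) = 0"
          using uinit_dim by (simp add: vnorm_eq_0_iff minus_cancel_vec)
        then show ?thesis
          using step[OF that] by (simp add: start_state_def)
      qed
      show "a (Suc k) * vnorm (ut (Suc k) - u (Suc k)) \<le>
          vnorm (window_residual N Nt \<alpha> \<beta> s dt t f (Suc k) (ut (Suc k))
            (start_state N uinit ut (Suc k))) + b (Suc k) * vnorm (ut k - u k)"
        if "Suc k < Nw" for k
        using step[OF that] mult_left_mono[OF start_diff b_nonneg[OF that], of k] that by simp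
    qed (rule b_nonneg)
  qed
qed

end
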